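(* Let $U\subset\mathbb{R}^2$ be open, $\mathbf{x}:U\to\mathbb{R}^3$ a frontal, $\Omega:U\to\mathcal{M}_{3\times2}(\mathbb{R})$ a tangent moving base of $\mathbf{x}$ and $p\in\Sigma(\mathbf{x})$. Then: (i) $\mathbf{x}$ is a front on some neighborhood $V$ of $p$ and $\mathrm{rank}(D\mathbf{x}(p))=1$ if and only if $H_\Omega(p)\neq0$; (ii) $\mathbf{x}$ is a front on some neighborhood $V$ of $p$ and $\mathrm{rank}(D\mathbf{x}(p))=0$ if and only if $H_\Omega(p)=0$ and $K_\Omega(p)\neq0$.
   Context: Smooth means $C^\infty$; $D\mathbf{f}$ is the Jacobian matrix. A smooth map $\mathbf{x}:U\to\mathbb{R}^3$ is a frontal if for every $p\in U$ there are an open neighborhood $V_p\subset U$ of $p$ and a smooth $\nu:V_p\to\mathbb{R}^3$ with $|\nu|=1$ and $\nu\cdot\mathbf{x}_u=\nu\cdot\mathbf{x}_v=0$ on $V_p$. A tangent moving base of $\mathbf{x}$ is a smooth map $\Omega=(\mathbf{w}_1\ \mathbf{w}_2):U\to\mathcal{M}_{3\times2}(\mathbb{R})$ whose columns are linearly independent at every point and such that $\mathbf{x}_u,\mathbf{x}_v\in\mathrm{span}(\mathbf{w}_1,\mathbf{w}_2)$ at every point. Given $\Omega$: $\mathbf{n}=\frac{\mathbf{w}_1\times\mathbf{w}_2}{\|\mathbf{w}_1\times\mathbf{w}_2\|}$ (the unit normal field used for $\mathbf{x}$); $\mathbf{I}_\Omega:=\Omega^T\Omega$; $\mathbf{II}_\Omega:=-\Omega^TD\mathbf{n}$;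 $\mu:=-\mathbf{II}_\Omega^T\mathbf{I}_\Omega^{-1}$; $\Lambda:=D\mathbf{x}^T\Omega\,\mathbf{I}_\Omega^{-1}$ (so $D\mathbf{x}=\Omega\Lambda^T$). The $\Omega$-relative curvature is $K_\Omega:=\det\mu$ and the $\Omega$-relative mean curvature is $H_\Omega:=-\frac12\mathrm{tr}(\mu\,\mathrm{adj}(\Lambda))$, where $\mathrm{adj}$ is the adjugate matrix. $\Sigma(\mathbf{x})$ is the set of points of $U$ where $\mathbf{x}$ is not immersive. A frontal is a front on an open set $V$ if $(\mathbf{x},\mathbf{n}):V\to\mathbb{R}^3\times\mathbb{R}^3$ is an immersion at every point of $V$. *)

theory Defs
  imports "HOL-Analysis.Analysis"
begin

text \<open>
  Matrices with m rows and n columns have type \<open>real^'n^'m\<close>; thus the Jacobian matrix of a map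
  \<open>real^2 \<Rightarrow> real^3\<close>, with columns \<open>x\<^sub>u\<close> and \<open>x\<^sub>v\<close>, has type \<open>real^2^3\<close>.
\<close>

text \<open>
  Differentiability classes via iterated directional derivatives. The derivatives are full ones,
  \<open>at p\<close>, so these notions are meant for open \<open>S\<close>.
\<close>

primrec Ck_on ::
  "nat \<Rightarrow> 'a::real_normed_vector set \<Rightarrow> ('a \<Rightarrow> 'b::real_normed_vector) \<Rightarrow> bool" where
  "Ck_on 0 S f \<longleftrightarrow> continuous_on S f"
| "Ck_on (Suc k) S f \<longleftrightarrow>
     (\<forall>p\<in>S. f differentiable (at p)) \<and>
     (\<forall>v. Ck_on k S (\<lambda>p. frechet_derivative f (at p) v))"

definition smooth_on ::
  "'a::real_normed_vector set \<Rightarrow> ('a \<Rightarrow> 'b::real_normed_vector) \<Rightarrow> bool" where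
  "smooth_on S f \<longleftrightarrow> (\<forall>k. Ck_on k S f)"

definition immersive_at ::
  "('a::real_normed_vector \<Rightarrow> 'b::real_normed_vector) \<Rightarrow> 'a \<Rightarrow> bool" where
  "immersive_at f p \<longleftrightarrow> f differentiable (at p) \<and> inj (frechet_derivative f (at p))"

abbreviation Jac :: "(real^2 \<Rightarrow> real^3) \<Rightarrow> real^2 \<Rightarrow> real^2^3" where
  "Jac f p \<equiv> jacobian f (at p)"

definition frontal_on :: "(real^2) set \<Rightarrow> (real^2 \<Rightarrow> real^3) \<Rightarrow> bool" where
  "frontal_on U x \<longleftrightarrow> smooth_on U x \<and>
     (\<forall>p\<in>U. \<exists>V \<nu>. open V \<and> p \<in> V \<and> V \<subseteq> U \<and> smooth_on V (\<nu> :: real^2 \<Rightarrow> real^3) \<and>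
        (\<forall>q\<in>V. norm (\<nu> q) = 1 \<and>
                \<nu> q \<bullet> column 1 (Jac x q) = 0 \<and> \<nu> q \<bullet> column 2 (Jac x q) = 0))"

text \<open>
  The condition \<open>w1 \<noteq> w2\<close> is needed because \<open>independent\<close> speaks about sets: equal nonzero columns
  would form an independent singleton.
\<close>

definition tangent_moving_base_on ::
  "(real^2) set \<Rightarrow> (real^2 \<Rightarrow> real^3) \<Rightarrow> (real^2 \<Rightarrow> real^2^3) \<Rightarrow> bool" where
  "tangent_moving_base_on U x \<Omega> \<longleftrightarrow> smooth_on U \<Omega> \<and>
     (\<forall>p\<in>U. let w1 = column 1 (\<Omega> p); w2 = column 2 (\<Omega> p) in
        w1 \<noteq> w2 \<and> independent {w1, w2} \<and>
        column 1 (Jac x p) \<in> span {w1, w2} \<and> column 2 (Jac x p) \<in> span {w1, w2})"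

definition unit_normal :: "(real^2 \<Rightarrow> real^2^3) \<Rightarrow> real^2 \<Rightarrow> real^3" where
  "unit_normal \<Omega> p =
     (let c = cross3 (column 1 (\<Omega> p)) (column 2 (\<Omega> p)) in (1 / norm c) *\<^sub>R c)"

definition I_form :: "(real^2 \<Rightarrow> real^2^3) \<Rightarrow> real^2 \<Rightarrow> real^2^2" where
  "I_form \<Omega> p = transpose (\<Omega> p) ** \<Omega> p"

definition II_form :: "(real^2 \<Rightarrow> real^2^3) \<Rightarrow> real^2 \<Rightarrow> real^2^2" where
  "II_form \<Omega> p = - (transpose (\<Omega> p) ** Jac (unit_normal \<Omega>) p)"

definition mu_matrix :: "(real^2 \<Rightarrow> real^2^3) \<Rightarrow> real^2 \<Rightarrow> real^2^2" where
  "mu_matrix \<Omega> p = - (transpose (II_form \<Omega> p) ** matrix_inv (I_form \<Omega> p))"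

definition Lambda_matrix ::
  "(real^2 \<Rightarrow> real^3) \<Rightarrow> (real^2 \<Rightarrow> real^2^3) \<Rightarrow> real^2 \<Rightarrow> real^2^2" where
  "Lambda_matrix x \<Omega> p = transpose (Jac x p) ** \<Omega> p ** matrix_inv (I_form \<Omega> p)"

definition adjugate2 :: "real^2^2 \<Rightarrow> real^2^2" where
  "adjugate2 A = vector [vector [  A$2$2, - (A$1$2)],
                         vector [- (A$2$1),   A$1$1]]"

lemma adjugate2_mult:
  "A ** adjugate2 A = det A *\<^sub>R mat 1" "adjugate2 A ** A = det A *\<^sub>R mat 1"
  by (simp_all add: adjugate2_def matrix_matrix_mult_def vec_eq_iff forall_2 sum_2 det_2 mat_def)

definition rel_curvature :: "(real^2 \<Rightarrow> real^2^3) \<Rightarrow> real^2 \<Rightarrow> real" where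
  "rel_curvature \<Omega> p = det (mu_matrix \<Omega> p)"

definition rel_mean_curvature ::
  "(real^2 \<Rightarrow> real^3) \<Rightarrow> (real^2 \<Rightarrow> real^2^3) \<Rightarrow> real^2 \<Rightarrow> real" where
  "rel_mean_curvature x \<Omega> p =
     - (1 / 2) * trace (mu_matrix \<Omega> p ** adjugate2 (Lambda_matrix x \<Omega> p))"

definition singular_set :: "(real^2) set \<Rightarrow> (real^2 \<Rightarrow> real^3) \<Rightarrow> (real^2) set" where
  "singular_set U x = {p \<in> U. \<not> immersive_at x p}"

definition front_on ::
  "(real^2) set \<Rightarrow> (real^2 \<Rightarrow> real^3) \<Rightarrow> (real^2 \<Rightarrow> real^3) \<Rightarrow> bool" where
  "front_on V x n \<longleftrightarrow> frontal_on V x \<and> (\<forall>q\<in>V. immersive_at (\<lambda>r. (x r, n r)) q)"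

end

(*
  Both Dx and Dn have their columns in the plane spanned by the moving base, so at p they factor as
  Dx = Omega Lambda^T and Dn = Omega mu^T, and (x, n) is immersive at p iff Lambda^T and mu^T have
  no common kernel vector; this is an open condition, so being a front near p is decided at p.
  If Lambda = 0 it says det mu /= 0. If Lambda has rank one with kernel vector v of Lambda^T, then
  tr(mu adj Lambda) vanishes iff mu^T v lies in the range of Lambda^T. Differentiating
  x_u . n = x_v . n = 0 and using x_uv = x_vu shows that Dx^T Dn is symmetric, and this forces
  mu^T v = 0 in that case.
*)
theory Submission
  imports Defs
begin

section \<open>Smooth maps and frontals on smaller sets\<close>

lemma Ck_on_subset: "Ck_on k S f \<Longrightarrow> T \<subseteq> S \<Longrightarrow> Ck_on k T f"
  by (induction k arbitrary: f) (auto intro: continuous_on_subset)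

lemma smooth_on_subset: "smooth_on S f \<Longrightarrow> T \<subseteq> S \<Longrightarrow> smooth_on T f"
  by (auto simp: smooth_on_def intro: Ck_on_subset)

lemma
  assumes "smooth_on S f"
  shows smooth_on_imp_differentiable: "p \<in> S \<Longrightarrow> f differentiable (at p)"
    and smooth_on_directional_derivative: "smooth_on S (\<lambda>p. frechet_derivative f (at p) v)"
    and smooth_on_imp_continuous_on: "continuous_on S f"
proof -
  have *: "Ck_on k S f" for k using assms by (simp add: smooth_on_def)
  show "p \<in> S \<Longrightarrow> f differentiable (at p)" using *[of "Suc 0"] by simp
  show "smooth_on S (\<lambda>p. frechet_derivative f (at p) v)"
    using * Ck_on.simps(2) unfolding smooth_on_def by blast
  show "continuous_on S f" using *[of 0] by simp
qed

lemma frontal_on_subset: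
  assumes "frontal_on U x" "V \<subseteq> U" "open V"
  shows "frontal_on V x"
  unfolding frontal_on_def
proof (intro conjI ballI)
  show "smooth_on V x" using assms by (auto simp: frontal_on_def intro: smooth_on_subset)
next
  fix p assume "p \<in> V"
  with assms obtain W \<nu> where W: "open W" "p \<in> W" "smooth_on W \<nu>"
    "\<forall>q\<in>W. norm (\<nu> q) = 1 \<and> \<nu> q \<bullet> column 1 (Jac x q) = 0 \<and> \<nu> q \<bullet> column 2 (Jac x q) = 0"
    unfolding frontal_on_def by blast
  show "\<exists>W \<nu>. open W \<and> p \<in> W \<and> W \<subseteq> V \<and> smooth_on W \<nu> \<and>
      (\<forall>q\<in>W. norm (\<nu> q) = 1 \<and> \<nu> q \<bullet> column 1 (Jac x q) = 0 \<and> \<nu> q \<bullet> column 2 (Jac x q) = 0)"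
    using W \<open>p \<in> V\<close> \<open>open V\<close>
    by (intro exI[of _ "W \<inter> V"] exI[of _ \<nu>]) (auto intro: smooth_on_subset)
qed

section \<open>Symmetry of second derivatives\<close>

lemma continuous_on_open_tendsto_nhds:
  "continuous_on U g \<Longrightarrow> open U \<Longrightarrow> p \<in> U \<Longrightarrow> (g \<longlongrightarrow> g p) (nhds p)"
  unfolding tendsto_at_iff_tendsto_nhds[symmetric] by (metis at_within_open continuous_on_def)

text \<open>The second difference over a parallelogram is the increment in \<open>s\<close> of the
  difference of \<open>f\<close> along two opposite sides. The mean value theorem in
  \<open>s\<close> turns it into a difference of values of \<open>f' _ v\<close>, and the mean value
  theorem in \<open>t\<close> then brings in \<open>f''\<close>. Continuity of \<open>f''\<close>
  does not enter at this stage.\<close>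

lemma second_difference_mvt:
  fixes f :: "'a::real_normed_vector \<Rightarrow> real"
  assumes "h > 0"
    and in_U: "\<And>s t. \<lbrakk>0 \<le> s; s \<le> h; 0 \<le> t; t \<le> h\<rbrakk> \<Longrightarrow> p + s *\<^sub>R v + t *\<^sub>R w \<in> U"
    and f': "\<And>q. q \<in> U \<Longrightarrow> (f has_derivative f' q) (at q)"
    and f'': "\<And>q. q \<in> U \<Longrightarrow> ((\<lambda>q. f' q v) has_derivative f'' q) (at q)"
  shows "\<exists>s\<in>{0..h}. \<exists>t\<in>{0..h}.
    f (p + h *\<^sub>R v + h *\<^sub>R w) - f (p + h *\<^sub>R v) - f (p + h *\<^sub>R w) + f p
       = h * h * f'' (p + s *\<^sub>R v + t *\<^sub>R w) w"
proof -
  let ?q = "\<lambda>s t. p + s *\<^sub>R v + t *\<^sub>R w"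
  have ray: "(g has_derivative L) (at q) \<Longrightarrow> L (c *\<^sub>R u) = c * L u"
    for g :: "'a \<Rightarrow> real" and L q c u
    using linear_scale[OF has_derivative_linear] by fastforce
  have "\<exists>s\<in>{0..h}. (f (?q h h) - f (?q h 0)) - (f (?q 0 h) - f (?q 0 0)) =
          f' (?q s h) ((h - 0) *\<^sub>R v) - f' (?q s 0) ((h - 0) *\<^sub>R v)"
  proof (rule mvt_very_simple)
    fix s assume s: "0 \<le> s" "s \<le> h"
    have "((\<lambda>s. f (?q s t)) has_derivative (\<lambda>r. f' (?q s t) (r *\<^sub>R v))) (at s within {0..h})"
      if "0 \<le> t" "t \<le> h" for t
      by (rule has_derivative_compose[where f = "\<lambda>s. ?q s t" and g = f])
        (use s that in \<open>auto intro!: derivative_eq_intros f' in_U\<close>)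
    from this[of h] this[of 0] show "((\<lambda>s. f (?q s h) - f (?q s 0)) has_derivative
        (\<lambda>r. f' (?q s h) (r *\<^sub>R v) - f' (?q s 0) (r *\<^sub>R v))) (at s within {0..h})"
      using \<open>h > 0\<close> by (intro has_derivative_diff) simp_all
  qed (use \<open>h > 0\<close> in auto)
  then obtain s where s: "0 \<le> s" "s \<le> h"
    and eq: "(f (?q h h) - f (?q h 0)) - (f (?q 0 h) - f (?q 0 0)) =
          f' (?q s h) ((h - 0) *\<^sub>R v) - f' (?q s 0) ((h - 0) *\<^sub>R v)" by auto
  have eq1: "f (?q h h) - f (?q h 0) - f (?q 0 h) + f (?q 0 0) = h * (f' (?q s h) v - f' (?q s 0) v)"
  proof -
    have "f' (?q s t) ((h - 0) *\<^sub>R v) = h * f' (?q s t) v" if "0 \<le> t" "t \<le> h" for t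
      using ray[OF f'[OF in_U[OF s that]]] by simp
    from this[of h] this[of 0] eq \<open>h > 0\<close> show ?thesis
      unfolding right_diff_distrib by linarith
  qed
  have "\<exists>t\<in>{0..h}. f' (?q s h) v - f' (?q s 0) v = f'' (?q s t) ((h - 0) *\<^sub>R w)"
  proof (rule mvt_very_simple)
    fix t assume t: "0 \<le> t" "t \<le> h"
    show "((\<lambda>t. f' (?q s t) v) has_derivative (\<lambda>r. f'' (?q s t) (r *\<^sub>R w))) (at t within {0..h})"
      by (rule has_derivative_compose[where f = "?q s" and g = "\<lambda>q. f' q v"])
        (use s t in \<open>auto intro!: derivative_eq_intros f'' in_U\<close>)
  qed (use \<open>h > 0\<close> in auto)
  then obtain t where t: "0 \<le> t" "t \<le> h" and eq2: "f' (?q s h) v - f' (?q s 0) v = h * f'' (?q s t) w"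
    using ray[OF f''[OF in_U]] s by auto
  show ?thesis
    using s t eq1 eq2 by (intro bexI[of _ s] bexI[of _ t]) simp_all
qed

text \<open>The second difference does not change when \<open>v\<close> and \<open>w\<close> are
  exchanged, so over every small parallelogram some value of \<open>fv _ w\<close> equals some value
  of \<open>fw _ v\<close>. Continuity at \<open>p\<close> then excludes a gap between the two mixed
  derivatives.\<close>

lemma second_derivative_symmetric_real:
  fixes f :: "'a::real_normed_vector \<Rightarrow> real"
  assumes "open U" "p \<in> U"
    and f': "\<And>q. q \<in> U \<Longrightarrow> (f has_derivative f' q) (at q)"
    and fv: "\<And>q. q \<in> U \<Longrightarrow> ((\<lambda>q. f' q v) has_derivative fv q) (at q)"
    and fw: "\<And>q. q \<in> U \<Longrightarrow> ((\<lambda>q. f' q w) has_derivative fw q) (at q)"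
    and cont: "continuous_on U (\<lambda>q. fv q w)" "continuous_on U (\<lambda>q. fw q v)"
  shows "fv p w = fw p v"
proof (rule ccontr)
  define e where "e = dist (fv p w) (fw p v) / 2"
  assume "fv p w \<noteq> fw p v"
  then have "e > 0" by (simp add: e_def)
  have "((\<lambda>q. fv q w) \<longlongrightarrow> fv p w) (nhds p)" "((\<lambda>q. fw q v) \<longlongrightarrow> fw p v) (nhds p)"
    using cont \<open>open U\<close> \<open>p \<in> U\<close> by (auto dest: continuous_on_open_tendsto_nhds)
  then have "\<forall>\<^sub>F q in nhds p. dist (fv q w) (fv p w) < e" "\<forall>\<^sub>F q in nhds p. dist (fw q v) (fw p v) < e"
    using \<open>e > 0\<close> by (auto dest: tendstoD)
  moreover have "\<forall>\<^sub>F q in nhds p. q \<in> U"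
    using \<open>open U\<close> \<open>p \<in> U\<close> by (rule eventually_nhds_in_open)
  ultimately have "\<forall>\<^sub>F q in nhds p. q \<in> U \<and> dist (fv q w) (fv p w) < e \<and> dist (fw q v) (fw p v) < e"
    by eventually_elim auto
  then obtain d where "d > 0" and d: "\<And>q. dist q p < d \<Longrightarrow>
      q \<in> U \<and> dist (fv q w) (fv p w) < e \<and> dist (fw q v) (fw p v) < e"
    by (auto simp: eventually_nhds_metric)
  \<comment> \<open>This size keeps the whole parallelogram with sides \<open>h *\<^sub>R v\<close>
    and \<open>h *\<^sub>R w\<close> inside the ball of radius \<open>d\<close>. The summand 1 keeps
    the denominator positive when \<open>v\<close> and \<open>w\<close> both vanish and makes the
    later estimate strict.\<close>
  define h where "h = d / (norm v + norm w + 1)"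
  have pos: "norm v + norm w + 1 > 0" by (simp add: add_nonneg_pos)
  have "h > 0" using \<open>d > 0\<close> pos by (simp add: h_def)
  have near: "dist (p + s *\<^sub>R v + t *\<^sub>R w) p < d" if "0 \<le> s" "s \<le> h" "0 \<le> t" "t \<le> h" for s t
  proof -
    have "dist (p + s *\<^sub>R v + t *\<^sub>R w) p \<le> norm (s *\<^sub>R v) + norm (t *\<^sub>R w)"
      unfolding dist_norm using norm_triangle_ineq[of "s *\<^sub>R v" "t *\<^sub>R w"] by (simp add: algebra_simps)
    also have "\<dots> \<le> h * norm v + h * norm w"
      using that by (auto intro!: add_mono mult_right_mono)
    also have "\<dots> < h * (norm v + norm w + 1)"
      using \<open>h > 0\<close> by (simp add: algebra_simps)
    also have "\<dots> = d" using pos by (simp add: h_def)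
    finally show ?thesis .
  qed
  have near': "dist (p + s *\<^sub>R w + t *\<^sub>R v) p < d" if "0 \<le> s" "s \<le> h" "0 \<le> t" "t \<le> h" for s t
    using near[OF that(3,4,1,2)] by (simp add: algebra_simps)
  have in_U: "p + s *\<^sub>R v + t *\<^sub>R w \<in> U" and in_U': "p + s *\<^sub>R w + t *\<^sub>R v \<in> U"
    if "0 \<le> s" "s \<le> h" "0 \<le> t" "t \<le> h" for s t
    using d[OF near[OF that]] d[OF near'[OF that]] by simp_all
  have "\<exists>s\<in>{0..h}. \<exists>t\<in>{0..h}.
      f (p + h *\<^sub>R v + h *\<^sub>R w) - f (p + h *\<^sub>R v) - f (p + h *\<^sub>R w) + f p
        = h * h * fv (p + s *\<^sub>R v + t *\<^sub>R w) w"
    by (rule second_difference_mvt[of h p v w U f f' fv]) (fact \<open>h > 0\<close> in_U f' fv)+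
  then obtain s t where st: "0 \<le> s" "s \<le> h" "0 \<le> t" "t \<le> h"
    and eq: "f (p + h *\<^sub>R v + h *\<^sub>R w) - f (p + h *\<^sub>R v) - f (p + h *\<^sub>R w) + f p
       = h * h * fv (p + s *\<^sub>R v + t *\<^sub>R w) w"
    unfolding Bex_def atLeastAtMost_iff by blast
  have "\<exists>s\<in>{0..h}. \<exists>t\<in>{0..h}.
      f (p + h *\<^sub>R w + h *\<^sub>R v) - f (p + h *\<^sub>R w) - f (p + h *\<^sub>R v) + f p
        = h * h * fw (p + s *\<^sub>R w + t *\<^sub>R v) v"
    by (rule second_difference_mvt[of h p w v U f f' fw]) (fact \<open>h > 0\<close> in_U' f' fw)+
  then obtain s' t' where st': "0 \<le> s'" "s' \<le> h" "0 \<le> t'" "t' \<le> h"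
    and eq': "f (p + h *\<^sub>R w + h *\<^sub>R v) - f (p + h *\<^sub>R w) - f (p + h *\<^sub>R v) + f p
       = h * h * fw (p + s' *\<^sub>R w + t' *\<^sub>R v) v"
    unfolding Bex_def atLeastAtMost_iff by blast
  have "f (p + h *\<^sub>R v + h *\<^sub>R w) = f (p + h *\<^sub>R w + h *\<^sub>R v)"
    by (simp add: algebra_simps)
  then have "h * h * fv (p + s *\<^sub>R v + t *\<^sub>R w) w = h * h * fw (p + s' *\<^sub>R w + t' *\<^sub>R v) v"
    using eq eq' by linarith
  then have fv_fw: "fv (p + s *\<^sub>R v + t *\<^sub>R w) w = fw (p + s' *\<^sub>R w + t' *\<^sub>R v) v"
    using \<open>h > 0\<close> by simp
  \<comment> \<open>The common value lies within half the gap of both \<open>fv p w\<close> and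
    \<open>fw p v\<close>, so the gap would be smaller than itself.\<close>
  have "dist (fv p w) (fw p v) < dist (fv p w) (fw p v)"
  proof (rule dist_triangle_half_r)
    show "dist (fv (p + s *\<^sub>R v + t *\<^sub>R w) w) (fv p w) < dist (fv p w) (fw p v) / 2"
      using d[OF near[OF st]] by (simp add: e_def)
    show "dist (fv (p + s *\<^sub>R v + t *\<^sub>R w) w) (fw p v) < dist (fv p w) (fw p v) / 2"
      unfolding fv_fw using d[OF near'[OF st']] by (simp add: e_def)
  qed
  then show False by simp
qed

text \<open>Reduction to the real case by taking inner products with an arbitrary fixed vector
  \<open>c\<close>.\<close>

lemma second_derivative_symmetric:
  fixes f :: "'a::real_normed_vector \<Rightarrow> 'b::real_inner"
  assumes "open U" "p \<in> U"
    and f': "\<And>q. q \<in> U \<Longrightarrow> (f has_derivative f' q) (at q)"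
    and fv: "\<And>q. q \<in> U \<Longrightarrow> ((\<lambda>q. f' q v) has_derivative fv q) (at q)"
    and fw: "\<And>q. q \<in> U \<Longrightarrow> ((\<lambda>q. f' q w) has_derivative fw q) (at q)"
    and cont: "continuous_on U (\<lambda>q. fv q w)" "continuous_on U (\<lambda>q. fw q v)"
  shows "fv p w = fw p v"
proof -
  have "fv p w \<bullet> c = fw p v \<bullet> c" for c
    by (rule second_derivative_symmetric_real[OF assms(1,2), of "\<lambda>q. f q \<bullet> c" "\<lambda>q u. f' q u \<bullet> c" v
          "\<lambda>q u. fv q u \<bullet> c" w "\<lambda>q u. fw q u \<bullet> c"])
      (use f' fv fw cont in \<open>auto intro!: has_derivative_inner_left continuous_intros\<close>)
  then have "(fv p w - fw p v) \<bullet> (fv p w - fw p v) = 0"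
    by (metis inner_diff_left right_minus_eq)
  then show ?thesis by simp
qed

lemma smooth_on_second_derivative_symmetric:
  fixes f :: "'a::real_normed_vector \<Rightarrow> 'b::real_inner"
  assumes "open U" "p \<in> U" "smooth_on U f"
  shows "frechet_derivative (\<lambda>q. frechet_derivative f (at q) v) (at p) w =
         frechet_derivative (\<lambda>q. frechet_derivative f (at q) w) (at p) v"
proof (rule second_derivative_symmetric[OF assms(1,2)])
  note s1 = smooth_on_directional_derivative[OF assms(3)]
  show "(f has_derivative frechet_derivative f (at q)) (at q)" if "q \<in> U" for q
    using smooth_on_imp_differentiable[OF assms(3) that] frechet_derivative_works by blast
  have "((\<lambda>q. frechet_derivative f (at q) u) has_derivative
      frechet_derivative (\<lambda>q. frechet_derivative f (at q) u) (at q)) (at q)" if "q \<in> U" for q u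
    using smooth_on_imp_differentiable[OF s1 that] frechet_derivative_works by blast
  then show "((\<lambda>q. frechet_derivative f (at q) v) has_derivative
        frechet_derivative (\<lambda>q. frechet_derivative f (at q) v) (at q)) (at q)"
      "((\<lambda>q. frechet_derivative f (at q) w) has_derivative
        frechet_derivative (\<lambda>q. frechet_derivative f (at q) w) (at q)) (at q)" if "q \<in> U" for q
    using that by blast+
  show "continuous_on U (\<lambda>q. frechet_derivative (\<lambda>q. frechet_derivative f (at q) v) (at q) w)"
    "continuous_on U (\<lambda>q. frechet_derivative (\<lambda>q. frechet_derivative f (at q) w) (at q) v)"
    by (intro smooth_on_imp_continuous_on smooth_on_directional_derivative assms(3))+
qed

section \<open>Stability of immersions\<close>

text \<open>An injective linear map on a finite-dimensional space is bounded below by some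
  \<open>B > 0\<close>, and a perturbation of norm less than \<open>B\<close> cannot create a
  kernel. The perturbation is controlled by its values on the basis, so continuity in each fixed
  direction suffices.\<close>

lemma eventually_immersive_at:
  fixes f :: "'a::euclidean_space \<Rightarrow> 'b::euclidean_space"
  assumes "open U" "p \<in> U"
    and f': "\<And>q. q \<in> U \<Longrightarrow> (f has_derivative f' q) (at q)"
    and cont: "\<And>v. continuous_on U (\<lambda>q. f' q v)"
    and "immersive_at f p"
  shows "\<forall>\<^sub>F q in nhds p. immersive_at f q"
proof -
  have f'_eq: "frechet_derivative f (at q) = f' q" if "q \<in> U" for q
    using frechet_derivative_at[OF f'[OF that]] by simp
  have lin: "linear (f' q)" if "q \<in> U" for q
    using f'[OF that] by (rule has_derivative_linear)
  have "inj (f' p)" using assms(5) f'_eq[OF assms(2)] by (simp add: immersive_at_def)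
  then obtain B where "B > 0" and B: "\<And>v. B * norm v \<le> norm (f' p v)"
    using linear_inj_bounded_below_pos[OF lin[OF assms(2)]] by metis
  have "((\<lambda>q. f' q b) \<longlongrightarrow> f' p b) (nhds p)" for b
    using cont assms(1,2) by (rule continuous_on_open_tendsto_nhds)
  then have "((\<lambda>q. \<Sum>b\<in>Basis. norm (f' q b - f' p b)) \<longlongrightarrow> (\<Sum>b\<in>Basis. norm (f' p b - f' p b))) (nhds p)"
    by (intro tendsto_intros)
  then have "((\<lambda>q. \<Sum>b\<in>Basis. norm (f' q b - f' p b)) \<longlongrightarrow> 0) (nhds p)"
    by simp
  then have "\<forall>\<^sub>F q in nhds p. (\<Sum>b\<in>Basis. norm (f' q b - f' p b)) < B"
    using \<open>B > 0\<close> by (rule order_tendstoD)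
  moreover have "\<forall>\<^sub>F q in nhds p. q \<in> U"
    using assms(1,2) by (rule eventually_nhds_in_open)
  ultimately show ?thesis
  proof eventually_elim
    case (elim q)
    have "v = 0" if "f' q v = 0" for v
    proof (rule ccontr)
      assume "v \<noteq> 0"
      have lin': "linear (\<lambda>u. f' q u - f' p u)"
        using lin elim assms(2) by (intro linear_compose_sub) auto
      \<comment> \<open>Since \<open>f' q v = 0\<close>, the right-hand side is just the norm of
        \<open>f' p v\<close>.\<close>
      have "B * norm v \<le> norm (f' q v - f' p v)"
        using B[of v] that by simp
      also have "f' q v - f' p v = (\<Sum>b\<in>Basis. (v \<bullet> b) *\<^sub>R (f' q b - f' p b))"
        using linear_sum[OF lin', of "\<lambda>b. (v \<bullet> b) *\<^sub>R b" Basis]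
        by (simp add: linear_scale[OF lin'] euclidean_representation)
      also have "norm \<dots> \<le> (\<Sum>b\<in>Basis. norm v * norm (f' q b - f' p b))"
        by (intro order_trans[OF norm_sum] sum_mono) (auto intro!: mult_right_mono Basis_le_norm)
      also have "\<dots> < norm v * B"
        using elim \<open>v \<noteq> 0\<close> by (simp flip: sum_distrib_left)
      finally show False by simp
    qed
    then have "inj (f' q)"
      using lin elim linear_injective_0 by blast
    then show ?case
      using f' f'_eq elim by (auto simp: immersive_at_def differentiable_def)
  qed
qed

section \<open>Continuous differentiability of the unit normal\<close>

lemma bounded_bilinear_cross3: "bounded_bilinear cross3"
  using bilinear_cross bilinear_conv_bounded_bilinear by blast

lemma bounded_linear_column: "bounded_linear (column i :: real^'n^'m \<Rightarrow> real^'m)"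
  by (auto intro!: linearI simp: linear_conv_bounded_linear[symmetric] column_def vec_eq_iff)

lemma matrix_vector_mult_columns_2:
  fixes A :: "real^2^'m"
  shows "A *v v = (v $ 1) *\<^sub>R column 1 A + (v $ 2) *\<^sub>R column 2 A"
  by (simp add: matrix_vector_mult_def column_def vec_eq_iff sum_2 mult.commute)

lemma has_derivative_normalize:
  fixes f :: "'a::real_normed_vector \<Rightarrow> 'b::real_inner"
  assumes "(f has_derivative f') (at p)" "f p \<noteq> 0"
  shows "((\<lambda>q. (1 / norm (f q)) *\<^sub>R f q) has_derivative
           (\<lambda>v. (1 / norm (f p)) *\<^sub>R f' v - ((f p \<bullet> f' v) / norm (f p) ^ 3) *\<^sub>R f p)) (at p)"
proof -
  have "((\<lambda>q. norm (f q)) has_derivative (\<lambda>v. f' v \<bullet> sgn (f p))) (at p)"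
    using has_derivative_compose[OF assms(1) has_derivative_norm[OF assms(2)]] .
  then have "((\<lambda>q. (1 / norm (f q)) *\<^sub>R f q) has_derivative
      (\<lambda>v. (1 / norm (f p)) *\<^sub>R f' v + (- ((f' v \<bullet> sgn (f p)) / (norm (f p))\<^sup>2)) *\<^sub>R f p)) (at p)"
    using assms by (auto intro!: derivative_eq_intros simp: power2_eq_square divide_simps)
  moreover have "(f' v \<bullet> sgn (f p)) / (norm (f p))\<^sup>2 = (f p \<bullet> f' v) / norm (f p) ^ 3" for v
    using assms(2) by (simp add: sgn_div_norm inner_commute divide_simps power2_eq_square power3_eq_cube)
  ultimately show ?thesis by simp
qed

text \<open>First-order regularity of the normal is what the openness of immersivity calls for. The
  derivative is written out by the product rule for \<open>cross3\<close> and the derivative of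
  normalization, so that its continuity can be read off term by term.\<close>

lemma unit_normal_C1:
  fixes \<Omega> :: "real^2 \<Rightarrow> real^2^3"
  assumes "smooth_on U \<Omega>"
    and nz: "\<And>q. q \<in> U \<Longrightarrow> cross3 (column 1 (\<Omega> q)) (column 2 (\<Omega> q)) \<noteq> 0"
  obtains n' where "\<And>q. q \<in> U \<Longrightarrow> (unit_normal \<Omega> has_derivative n' q) (at q)"
    "\<And>v. continuous_on U (\<lambda>q. n' q v)"
proof -
  define c where "c q = cross3 (column 1 (\<Omega> q)) (column 2 (\<Omega> q))" for q
  define D where "D q = frechet_derivative \<Omega> (at q)" for q
  define c' where "c' q v = cross3 (column 1 (\<Omega> q)) (column 2 (D q v)) +
    cross3 (column 1 (D q v)) (column 2 (\<Omega> q))" for q v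
  define n' where "n' q v = (1 / norm (c q)) *\<^sub>R c' q v - ((c q \<bullet> c' q v) / norm (c q) ^ 3) *\<^sub>R c q"
    for q v
  have nz': "c q \<noteq> 0" if "q \<in> U" for q using nz[OF that] by (simp add: c_def)
  have D: "(\<Omega> has_derivative D q) (at q)" if "q \<in> U" for q
    using smooth_on_imp_differentiable[OF assms(1) that] by (simp add: D_def frechet_derivative_works)
  have "(c has_derivative c' q) (at q)" if "q \<in> U" for q
    unfolding c_def[abs_def] c'_def[abs_def]
    by (intro bounded_bilinear.FDERIV[OF bounded_bilinear_cross3]
        bounded_linear.has_derivative[OF bounded_linear_column] D that)
  then have "(unit_normal \<Omega> has_derivative n' q) (at q)" if "q \<in> U" for q
    unfolding unit_normal_def[abs_def] Let_def n'_def[abs_def] c_def[symmetric]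
    using nz' that by (intro has_derivative_normalize) auto
  moreover have "continuous_on U (\<lambda>q. n' q v)" for v
  proof -
    have "continuous_on U (\<lambda>q. D q v)" "continuous_on U \<Omega>"
      unfolding D_def using assms(1) smooth_on_directional_derivative smooth_on_imp_continuous_on by blast+
    note col = this[THEN bounded_linear.continuous_on[OF bounded_linear_column]]
    have "continuous_on U c" "continuous_on U (\<lambda>q. c' q v)"
      unfolding c_def[abs_def] c'_def
      by (intro continuous_on_add continuous_on_cross col)+
    then show ?thesis
      unfolding n'_def using nz' by (intro continuous_intros) auto
  qed
  ultimately show ?thesis using that by blast
qed

section \<open>Linear algebra of the plane spanned by a moving base\<close>

lemma cross3_nonzero_if_independent:
  assumes "independent {w1, w2 :: real^3}" "w1 \<noteq> w2"
  shows "cross3 w1 w2 \<noteq> 0"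
proof
  assume "cross3 w1 w2 = 0"
  then consider "w1 = 0" | "w2 = 0" | c where "w2 = c *\<^sub>R w1"
    by (auto simp: cross_eq_0 collinear_lemma)
  then show False
  proof cases
    case 3
    then have "w2 \<in> span {w1}" by (simp add: span_base span_scale)
    then have "dependent {w2, w1}" using assms(2) by (auto simp: dependent_def)
    then show False using assms(1) by (simp add: insert_commute)
  qed (use assms(1) dependent_zero in auto)
qed

text \<open>Two triple product expansions give this. Expanding \<open>cross3 c (cross3 y c)\<close>
  recovers \<open>y\<close> up to the factor \<open>c \<bullet> c\<close>, because \<open>y\<close>
  is orthogonal to \<open>c\<close>; expanding the same product through \<open>c\<close> as a cross
  product of columns exhibits it as a combination of these columns.\<close>

lemma cross3_eq_orthogonal_complement:
  fixes A :: "real^2^3"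
  defines "c \<equiv> cross3 (column 1 A) (column 2 A)"
  assumes "c \<noteq> 0" "y \<bullet> c = 0"
  obtains a where "y = A *v a"
proof -
  define z where "z = cross3 y c"
  have "(c \<bullet> c) *\<^sub>R y = cross3 c z + (c \<bullet> y) *\<^sub>R c"
    unfolding z_def by (simp add: cross3_simps forall_3)
  also have "\<dots> = (column 1 A \<bullet> z) *\<^sub>R column 2 A - (column 2 A \<bullet> z) *\<^sub>R column 1 A"
    using \<open>y \<bullet> c = 0\<close> by (simp add: inner_commute c_def) (simp add: cross3_simps forall_3)
  finally have *: "(c \<bullet> c) *\<^sub>R y = A *v vector [- (column 2 A \<bullet> z), column 1 A \<bullet> z]"
    by (simp add: matrix_vector_mult_columns_2)
  have "y = (1 / (c \<bullet> c)) *\<^sub>R ((c \<bullet> c) *\<^sub>R y)" using \<open>c \<noteq> 0\<close> by simp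
  also have "\<dots> = A *v ((1 / (c \<bullet> c)) *\<^sub>R vector [- (column 2 A \<bullet> z), column 1 A \<bullet> z])"
    unfolding * by (simp add: matrix_vector_mult_scaleR)
  finally show ?thesis by (rule that)
qed

text \<open>The Gram matrix is symmetric, and it is invertible because its quadratic form at
  \<open>v\<close> is the squared norm of \<open>W *v v\<close>. This yields a left inverse of
  \<open>W\<close>, in the transposed form that occurs in the transposes of
  \<open>Lambda_matrix\<close> and \<open>mu_matrix\<close>.\<close>

lemma matrix_inv_gram_mult:
  fixes W :: "real^'n^'m"
  assumes "inj ((*v) W)"
  shows "transpose (matrix_inv (transpose W ** W)) *v (transpose W *v (W *v y)) = y"
proof -
  let ?I = "transpose W ** W"
  have "v = 0" if "?I *v v = 0" for v
  proof -
    have "(W *v v) \<bullet> (W *v v) = v \<bullet> (?I *v v)"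
      by (metis dot_lmul_matrix matrix_vector_mul_assoc transpose_matrix_vector inner_commute)
    then have "W *v v = 0" using that by simp
    then show ?thesis using assms by (metis injD matrix_vector_mult_0_right)
  qed
  then have "invertible ?I"
    by (metis invertible_left_inverse matrix_left_invertible_ker)
  have "transpose ?I = ?I" by (simp add: matrix_transpose_mul)
  then have "transpose (matrix_inv ?I) ** ?I = transpose (?I ** matrix_inv ?I)"
    by (simp add: matrix_transpose_mul)
  also have "\<dots> = mat 1"
    using someI_ex[OF \<open>invertible ?I\<close>[unfolded invertible_def]] by (simp add: matrix_inv_def)
  finally show ?thesis
    by (metis matrix_vector_mul_assoc matrix_vector_mul_lid)
qed

text \<open>The matrix \<open>transpose A\<close> has rank one: it sends \<open>z\<close> to the
  vector with entries \<open>s\<close> and \<open>t\<close>, multiplied by the determinant of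
  \<open>v\<close> and \<open>z\<close>. The trace is, up to sign, the determinant of
  (\<open>s\<close>, \<open>t\<close>) and \<open>transpose M *v v\<close>, so it vanishes exactly
  when these two are parallel.\<close>

lemma trace_mult_adjugate2_eq_0_iff:
  fixes A M :: "real^2^2"
  assumes "A \<noteq> 0" "v \<noteq> 0" "transpose A *v v = 0"
  shows "trace (M ** adjugate2 A) = 0 \<longleftrightarrow> transpose M *v v \<in> range ((*v) (transpose A))"
proof -
  define r where "r = (v $ 1)\<^sup>2 + (v $ 2)\<^sup>2"
  have v: "v $ 1 \<noteq> 0 \<or> v $ 2 \<noteq> 0"
    using assms(2) by (simp add: vec_eq_iff forall_2)
  then have "r \<noteq> 0" by (simp add: r_def)
  have ker: "A $ 1 $ 1 * v $ 1 + A $ 2 $ 1 * v $ 2 = 0" "A $ 1 $ 2 * v $ 1 + A $ 2 $ 2 * v $ 2 = 0"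
    using assms(3) by (simp_all add: vec_eq_iff forall_2 matrix_vector_mult_def sum_2 transpose_def)
  \<comment> \<open>Both columns of \<open>A\<close> are orthogonal to \<open>v\<close>, hence
    multiples of \<open>v\<close> rotated by a right angle. The factors \<open>s\<close> and
    \<open>t\<close> are the coefficients of these projections.\<close>
  define s where "s = (A $ 2 $ 1 * v $ 1 - A $ 1 $ 1 * v $ 2) / r"
  define t where "t = (A $ 2 $ 2 * v $ 1 - A $ 1 $ 2 * v $ 2) / r"
  have A: "A $ 1 $ 1 = - s * v $ 2" "A $ 2 $ 1 = s * v $ 1" "A $ 1 $ 2 = - t * v $ 2" "A $ 2 $ 2 = t * v $ 1"
    unfolding s_def t_def using \<open>r \<noteq> 0\<close> ker by (simp_all add: field_simps) (unfold r_def, algebra+)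
  have st: "s \<noteq> 0 \<or> t \<noteq> 0"
    using assms(1) A by (auto simp: vec_eq_iff forall_2)
  define y where "y = transpose M *v v"
  have "trace (M ** adjugate2 A) = t * y $ 1 - s * y $ 2"
    unfolding y_def trace_def adjugate2_def
    by (simp add: sum_2 matrix_matrix_mult_def matrix_vector_mult_def transpose_def A algebra_simps)
  moreover have im: "transpose A *v z = y \<longleftrightarrow>
      s * (v $ 1 * z $ 2 - v $ 2 * z $ 1) = y $ 1 \<and> t * (v $ 1 * z $ 2 - v $ 2 * z $ 1) = y $ 2" for z
    by (simp add: vec_eq_iff forall_2 sum_2 matrix_vector_mult_def transpose_def A algebra_simps)
  moreover have "y \<in> range ((*v) (transpose A))" if ty: "t * y $ 1 = s * y $ 2"
  proof -
    \<comment> \<open>The proportionality factor between \<open>y\<close> and (\<open>s\<close>,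
      \<open>t\<close>), read off from a coordinate that does not vanish.\<close>
    define k where "k = (if s \<noteq> 0 then y $ 1 / s else y $ 2 / t)"
    have k: "s * k = y $ 1" "t * k = y $ 2"
      using st ty by (auto simp: k_def field_simps)
    \<comment> \<open>The multiple of the rotated \<open>v\<close> whose determinant with
      \<open>v\<close> is \<open>k\<close>.\<close>
    define z :: "real^2" where "z = vector [- k * v $ 2 / r, k * v $ 1 / r]"
    have "v $ 1 * z $ 2 - v $ 2 * z $ 1 = k * (((v $ 1)\<^sup>2 + (v $ 2)\<^sup>2) / r)"
      by (simp add: z_def power2_eq_square add_divide_distrib algebra_simps)
    also have "\<dots> = k" using \<open>r \<noteq> 0\<close> by (simp flip: r_def)
    finally have "transpose A *v z = y"
      unfolding im using k by simp
    then show ?thesis by blast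
  qed
  moreover have "t * y $ 1 = s * y $ 2" if "y \<in> range ((*v) (transpose A))"
  proof -
    from that obtain z where "transpose A *v z = y" by blast
    then have "y $ 1 = s * (v $ 1 * z $ 2 - v $ 2 * z $ 1)" "y $ 2 = t * (v $ 1 * z $ 2 - v $ 2 * z $ 1)"
      unfolding im by simp_all
    then show ?thesis by simp
  qed
  ultimately show ?thesis unfolding y_def[symmetric] by auto
qed

section \<open>Differentials and their relation to the normal\<close>

lemma immersive_at_iff_kernel:
  assumes "(f has_derivative f') (at p)"
  shows "immersive_at f p \<longleftrightarrow> (\<forall>v. f' v = 0 \<longrightarrow> v = 0)"
  using assms frechet_derivative_at[OF assms] linear_injective_0[OF has_derivative_linear[OF assms]]
  by (auto simp: immersive_at_def differentiable_def)

lemma Jac_mult_eq: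
  assumes "(f has_derivative f') (at p)"
  shows "Jac f p *v v = f' v"
  using frechet_derivative_at[OF assms] has_derivative_linear[OF assms]
  by (simp add: jacobian_def matrix_works)

text \<open>Differentiating the orthogonality relation shows that each side is minus the normal
  component of a second derivative of \<open>x\<close>; the two sides differ only in the order of
  differentiation.\<close>

lemma orthogonal_derivative_symmetric:
  fixes x n :: "'a::real_normed_vector \<Rightarrow> 'b::real_inner"
  assumes "open U" "p \<in> U" "smooth_on U x"
    and n': "(n has_derivative n') (at p)"
    and orth: "\<And>q v. q \<in> U \<Longrightarrow> frechet_derivative x (at q) v \<bullet> n q = 0"
  shows "frechet_derivative x (at p) a \<bullet> n' b = frechet_derivative x (at p) b \<bullet> n' a"
proof -
  have "frechet_derivative x (at p) v \<bullet> n' w =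
      - (frechet_derivative (\<lambda>q. frechet_derivative x (at q) v) (at p) w \<bullet> n p)" for v w
  proof -
    let ?g = "\<lambda>q. frechet_derivative x (at q) v"
    have "(?g has_derivative frechet_derivative ?g (at p)) (at p)"
      using smooth_on_imp_differentiable[OF smooth_on_directional_derivative[OF assms(3)] assms(2)]
      by (simp add: frechet_derivative_works)
    then have "((\<lambda>q. ?g q \<bullet> n q) has_derivative
        (\<lambda>u. ?g p \<bullet> n' u + frechet_derivative ?g (at p) u \<bullet> n p)) (at p)"
      using n' by (rule has_derivative_inner)
    moreover have "((\<lambda>q. ?g q \<bullet> n q) has_derivative (\<lambda>u. 0)) (at p)"
      by (rule has_derivative_transform_within_open[OF has_derivative_const assms(1,2)])
        (use orth in auto)
    ultimately have "(\<lambda>u. ?g p \<bullet> n' u + frechet_derivative ?g (at p) u \<bullet> n p) = (\<lambda>u. 0)"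
      by (rule has_derivative_unique)
    then show ?thesis by (metis add_eq_0_iff2)
  qed
  then show ?thesis
    using smooth_on_second_derivative_symmetric[OF assms(1-3)] by metis
qed

section \<open>Rank, kernels and the pointwise criterion\<close>

lemma rank_eq_1_iff:
  fixes A :: "real^2^'m"
  assumes "A *v v = 0" "v \<noteq> 0"
  shows "rank A = 1 \<longleftrightarrow> A \<noteq> 0"
proof -
  have "rank A \<noteq> 2"
    using assms full_rank_injective[of A] injD[of "(*v) A" v 0] by auto
  moreover have "rank A \<le> 2"
    using rank_bound[of A] by simp
  ultimately show ?thesis
    using rank_eq_0[of A] by linarith
qed

lemma det_eq_0_iff_kernel:
  fixes A :: "real^'n^'n"
  shows "det A = 0 \<longleftrightarrow> (\<exists>v. v \<noteq> 0 \<and> A *v v = 0)"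
  by (metis invertible_det_nz invertible_left_inverse matrix_left_invertible_ker)

text \<open>
  \<open>X\<close> and \<open>N\<close> stand for the differentials of a frontal and of its unit normal, factored through
  the moving base \<open>W\<close>. If \<open>N v\<close> lies in the range of \<open>X\<close>, say \<open>N v = X z\<close>, and \<open>X v = 0\<close>, then by symmetry
  \<open>\<bar>N v\<bar>\<^sup>2 = X z \<bullet> N v = X v \<bullet> N z = 0\<close>.
\<close>

lemma relative_curvature_criterion:
  fixes W X N :: "real^2^3" and L M :: "real^2^2"
  assumes W: "inj ((*v) W)"
    and X: "\<And>v. X *v v = W *v (transpose L *v v)"
    and N: "\<And>v. N *v v = W *v (transpose M *v v)"
    and sym: "\<And>a b. (X *v a) \<bullet> (N *v b) = (X *v b) \<bullet> (N *v a)"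
    and sing: "u \<noteq> 0" "X *v u = 0"
  defines "I \<equiv> \<forall>v. X *v v = 0 \<and> N *v v = 0 \<longrightarrow> v = 0"
  shows "I \<and> rank X = 1 \<longleftrightarrow> trace (M ** adjugate2 L) \<noteq> 0"
    and "I \<and> rank X = 0 \<longleftrightarrow> trace (M ** adjugate2 L) = 0 \<and> det M \<noteq> 0"
proof -
  have W0: "W *v y = 0 \<longleftrightarrow> y = 0" for y
    using W by (metis injD matrix_vector_mult_0_right)
  have kerX: "X *v v = 0 \<longleftrightarrow> transpose L *v v = 0" and kerN: "N *v v = 0 \<longleftrightarrow> transpose M *v v = 0" for v
    by (simp_all only: X N W0)
  have X0: "X = 0 \<longleftrightarrow> L = 0"
  proof -
    have "X = 0 \<longleftrightarrow> transpose L = 0"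
      using kerX by (metis matrix_eq matrix_vector_mult_0)
    also have "\<dots> \<longleftrightarrow> L = 0"
      by (auto simp: transpose_def vec_eq_iff)
    finally show ?thesis .
  qed
  have nontrivial: "I \<longleftrightarrow> trace (M ** adjugate2 L) \<noteq> 0" if "L \<noteq> 0"
  proof -
    \<comment> \<open>The trace does not mention \<open>v\<close>, so \<open>N\<close> kills either
      every nonzero kernel vector of \<open>X\<close> or none. As \<open>u\<close> is such a vector,
      this decides \<open>I\<close>.\<close>
    have tr: "trace (M ** adjugate2 L) = 0 \<longleftrightarrow> N *v v = 0" if "v \<noteq> 0" "X *v v = 0" for v
    proof -
      have "N *v v = 0" if "transpose M *v v = transpose L *v z" for z
      proof -
        have "N *v v = X *v z" using that by (simp only: X N)
        then have "(N *v v) \<bullet> (N *v v) = (X *v v) \<bullet> (N *v z)" using sym by metis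
        then show ?thesis using \<open>X *v v = 0\<close> by simp
      qed
      moreover have "transpose M *v v = transpose L *v 0" if "N *v v = 0"
        using that kerN by simp
      ultimately have "transpose M *v v \<in> range ((*v) (transpose L)) \<longleftrightarrow> N *v v = 0"
        by blast
      then show ?thesis
        using trace_mult_adjugate2_eq_0_iff[OF \<open>L \<noteq> 0\<close> \<open>v \<noteq> 0\<close>] kerX that by metis
    qed
    show ?thesis unfolding I_def using tr sing by metis
  qed
  have trivial: "trace (M ** adjugate2 L) = 0 \<and> (I \<longleftrightarrow> det M \<noteq> 0)" if "L = 0"
  proof
    have "adjugate2 L = 0"
      using that by (simp add: adjugate2_def vec_eq_iff forall_2)
    then show "trace (M ** adjugate2 L) = 0" by (simp add: trace_def)
    have "X = 0" using that X0 by simp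
    have "det M = det (transpose M)" by (simp add: det_transpose)
    then show "I \<longleftrightarrow> det M \<noteq> 0"
      unfolding I_def using kerN det_eq_0_iff_kernel[of "transpose M"] \<open>X = 0\<close>
      by (metis matrix_vector_mult_0)
  qed
  \<comment> \<open>Needed for the backward direction of the rank 0 case: with \<open>I\<close>
    known, a vanishing trace contradicts \<open>nontrivial\<close> unless
    \<open>L = 0\<close>.\<close>
  have detM: "I" if "det M \<noteq> 0"
    using that det_eq_0_iff_kernel[of "transpose M"] kerN by (auto simp: I_def det_transpose)
  note rank1 = rank_eq_1_iff[OF sing(2,1)] and rank0 = rank_eq_0[of X]
  show "I \<and> rank X = 1 \<longleftrightarrow> trace (M ** adjugate2 L) \<noteq> 0"
    using rank1 X0 nontrivial trivial by blast
  show "I \<and> rank X = 0 \<longleftrightarrow> trace (M ** adjugate2 L) = 0 \<and> det M \<noteq> 0"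
    using rank0 X0 nontrivial trivial detM by blast
qed

section \<open>Fronts near a singular point of a frontal\<close>

theorem theorem3p22:
  fixes U :: "(real^2) set"
    and x :: "real^2 \<Rightarrow> real^3"
    and \<Omega> :: "real^2 \<Rightarrow> real^2^3"
    and p :: "real^2"
  assumes "open U"
    and "frontal_on U x"
    and "tangent_moving_base_on U x \<Omega>"
    and "p \<in> singular_set U x"
  shows "((\<exists>V. open V \<and> p \<in> V \<and> V \<subseteq> U \<and> front_on V x (unit_normal \<Omega>)) \<and>
            rank (jacobian x (at p)) = 1
          \<longleftrightarrow> rel_mean_curvature x \<Omega> p \<noteq> 0) \<and>
         ((\<exists>V. open V \<and> p \<in> V \<and> V \<subseteq> U \<and> front_on V x (unit_normal \<Omega>)) \<and>
            rank (jacobian x (at p)) = 0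
          \<longleftrightarrow> rel_mean_curvature x \<Omega> p = 0 \<and> rel_curvature \<Omega> p \<noteq> 0)"
proof -
  let ?n = "unit_normal \<Omega>"
  define c where "c q = cross3 (column 1 (\<Omega> q)) (column 2 (\<Omega> q))" for q
  have "p \<in> U" and sing: "\<not> immersive_at x p"
    using assms(4) by (auto simp: singular_set_def)
  have smooth_x: "smooth_on U x" and smooth_\<Omega>: "smooth_on U \<Omega>"
    using assms(2,3) by (auto simp: frontal_on_def tangent_moving_base_on_def)
  have base: "column 1 (\<Omega> q) \<noteq> column 2 (\<Omega> q)" "independent {column 1 (\<Omega> q), column 2 (\<Omega> q)}"
    "column i (Jac x q) \<in> span {column 1 (\<Omega> q), column 2 (\<Omega> q)}" if "q \<in> U" for q i
    using assms(3) that exhaust_2[of i] by (auto simp: tangent_moving_base_on_def Let_def)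
  have c0: "c q \<noteq> 0" if "q \<in> U" for q
    unfolding c_def using base(2,1)[OF that] by (rule cross3_nonzero_if_independent)
  define x' where "x' q = frechet_derivative x (at q)" for q
  have x': "(x has_derivative x' q) (at q)" if "q \<in> U" for q
    unfolding x'_def using smooth_on_imp_differentiable[OF smooth_x that]
    by (simp add: frechet_derivative_works)
  have cont_x': "continuous_on U (\<lambda>q. x' q v)" for v
    unfolding x'_def using smooth_x smooth_on_directional_derivative smooth_on_imp_continuous_on by blast
  obtain n' where n': "\<And>q. q \<in> U \<Longrightarrow> (?n has_derivative n' q) (at q)"
    and cont_n': "\<And>v. continuous_on U (\<lambda>q. n' q v)"
    using unit_normal_C1[OF smooth_\<Omega>] c0 unfolding c_def by metis
  have Jx: "Jac x q *v v = x' q v" and Jn: "Jac ?n q *v v = n' q v" if "q \<in> U" for q v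
    using Jac_mult_eq x' n' that by blast+

  have span_c: "y \<bullet> c q = 0" if "y \<in> span {column 1 (\<Omega> q), column 2 (\<Omega> q)}" for y q
    using that
    by (rule span_induct) (auto simp: subspace_def inner_add_left c_def dot_cross_self)
  have x'_c: "x' q v \<bullet> c q = 0" if "q \<in> U" for q v
    unfolding Jx[OF that, symmetric] matrix_vector_mult_columns_2
    using span_c[OF base(3)[OF that]] by (simp add: inner_add_left)
  have n_c: "?n q = (1 / norm (c q)) *\<^sub>R c q" for q
    by (simp add: unit_normal_def c_def Let_def)
  \<comment> \<open>Differentiating the constant squared length of the normal shows that its
    derivative is tangential.\<close>
  have n'_c: "n' p v \<bullet> c p = 0" for v
  proof -
    have "((\<lambda>q. ?n q \<bullet> ?n q) has_derivative (\<lambda>v. ?n p \<bullet> n' p v + n' p v \<bullet> ?n p)) (at p)"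
      using n'[OF \<open>p \<in> U\<close>] by (intro has_derivative_inner)
    moreover have "((\<lambda>q. ?n q \<bullet> ?n q) has_derivative (\<lambda>v. 0)) (at p)"
      by (rule has_derivative_transform_within_open[OF has_derivative_const[of 1] \<open>open U\<close> \<open>p \<in> U\<close>])
        (use c0 in \<open>auto simp: n_c dot_square_norm power2_eq_square\<close>)
    ultimately have "(\<lambda>v. ?n p \<bullet> n' p v + n' p v \<bullet> ?n p) = (\<lambda>v. 0)"
      by (rule has_derivative_unique)
    then have "?n p \<bullet> n' p v + n' p v \<bullet> ?n p = 0" by metis
    then show ?thesis using c0[OF \<open>p \<in> U\<close>] by (simp add: n_c inner_commute)
  qed

  \<comment> \<open>Crossing \<open>\<Omega> p *v v\<close> with one column isolates the coefficient
    of the other one as a multiple of \<open>c p\<close>.\<close>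
  have "inj ((*v) (\<Omega> p))"
  proof -
    have "v = 0" if "\<Omega> p *v v = 0" for v
    proof -
      have "cross3 (\<Omega> p *v v) (column 2 (\<Omega> p)) = (v $ 1) *\<^sub>R c p"
        "cross3 (column 1 (\<Omega> p)) (\<Omega> p *v v) = (v $ 2) *\<^sub>R c p"
        by (simp_all add: matrix_vector_mult_columns_2 cross_add_left cross_add_right
            cross_mult_left cross_mult_right c_def)
      then show ?thesis
        using that c0[OF \<open>p \<in> U\<close>] by (simp add: vec_eq_iff[of v 0] forall_2)
    qed
    then show ?thesis
      using linear_injective_0[OF matrix_vector_mul_linear] by blast
  qed
  \<comment> \<open>The orthogonal complement of \<open>c p\<close> is the column space of
    \<open>\<Omega> p\<close>, where a left inverse of \<open>\<Omega> p\<close> followed by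
    \<open>\<Omega> p\<close> is the identity.\<close>
  have factor: "\<Omega> p *v (transpose (matrix_inv (I_form \<Omega> p)) *v (transpose (\<Omega> p) *v y)) = y"
    if y: "y \<bullet> c p = 0" for y
  proof -
    obtain a where "y = \<Omega> p *v a"
      using cross3_eq_orthogonal_complement c0[OF \<open>p \<in> U\<close>] y unfolding c_def by metis
    then show ?thesis
      using matrix_inv_gram_mult[OF \<open>inj ((*v) (\<Omega> p))\<close>] by (simp only: I_form_def)
  qed
  have "transpose (Lambda_matrix x \<Omega> p) *v v =
      transpose (matrix_inv (I_form \<Omega> p)) *v (transpose (\<Omega> p) *v (Jac x p *v v))" for v
    by (simp add: Lambda_matrix_def matrix_transpose_mul matrix_vector_mul_assoc matrix_mul_assoc
        del: transpose_matrix_vector)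
  then have X: "Jac x p *v v = \<Omega> p *v (transpose (Lambda_matrix x \<Omega> p) *v v)" for v
    using factor[OF x'_c[OF \<open>p \<in> U\<close>]] Jx[OF \<open>p \<in> U\<close>] by metis
  \<comment> \<open>The minus signs in \<open>II_form\<close> and \<open>mu_matrix\<close> cancel,
    so \<open>mu_matrix\<close> relates to the normal as \<open>Lambda_matrix\<close> relates to
    \<open>x\<close>.\<close>
  have "mu_matrix \<Omega> p = transpose (Jac ?n p) ** \<Omega> p ** matrix_inv (I_form \<Omega> p)"
  proof -
    have "transpose (- A) ** B = - (transpose A ** B)" for A B :: "real^2^2"
      by (simp add: transpose_def matrix_matrix_mult_def vec_eq_iff sum_negf)
    then show ?thesis
      by (simp add: mu_matrix_def II_form_def matrix_transpose_mul)
  qed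
  then have "transpose (mu_matrix \<Omega> p) *v v =
      transpose (matrix_inv (I_form \<Omega> p)) *v (transpose (\<Omega> p) *v (Jac ?n p *v v))" for v
    by (simp add: matrix_transpose_mul matrix_vector_mul_assoc matrix_mul_assoc
        del: transpose_matrix_vector)
  then have N: "Jac ?n p *v v = \<Omega> p *v (transpose (mu_matrix \<Omega> p) *v v)" for v
    using factor[OF n'_c] Jn[OF \<open>p \<in> U\<close>] by metis

  have sym: "(Jac x p *v a) \<bullet> (Jac ?n p *v b) = (Jac x p *v b) \<bullet> (Jac ?n p *v a)" for a b
    unfolding Jx[OF \<open>p \<in> U\<close>] Jn[OF \<open>p \<in> U\<close>] unfolding x'_def
    by (rule orthogonal_derivative_symmetric[OF \<open>open U\<close> \<open>p \<in> U\<close> smooth_x n'[OF \<open>p \<in> U\<close>]])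
      (use x'_c in \<open>simp add: n_c x'_def\<close>)
  obtain u where u: "u \<noteq> 0" "Jac x p *v u = 0"
    using sing immersive_at_iff_kernel[OF x'[OF \<open>p \<in> U\<close>]] Jx[OF \<open>p \<in> U\<close>] by metis

  have pair: "((\<lambda>r. (x r, ?n r)) has_derivative (\<lambda>v. (x' q v, n' q v))) (at q)" if "q \<in> U" for q
    using x' n' that by (intro has_derivative_Pair)
  \<comment> \<open>Frontality passes to smaller open sets and immersivity persists near
    \<open>p\<close>, so the existence of \<open>V\<close> is a condition at \<open>p\<close>
    alone.\<close>
  have "(\<exists>V. open V \<and> p \<in> V \<and> V \<subseteq> U \<and> front_on V x ?n) \<longleftrightarrow> immersive_at (\<lambda>r. (x r, ?n r)) p"
  proof
    assume "immersive_at (\<lambda>r. (x r, ?n r)) p"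
    then have "\<forall>\<^sub>F q in nhds p. immersive_at (\<lambda>r. (x r, ?n r)) q"
      by (rule eventually_immersive_at[OF \<open>open U\<close> \<open>p \<in> U\<close> pair, rotated 2])
        (assumption, intro continuous_on_Pair cont_x' cont_n')
    then obtain T where T: "open T" "p \<in> T" "\<forall>q\<in>T. immersive_at (\<lambda>r. (x r, ?n r)) q"
      by (auto simp: eventually_nhds)
    moreover have "open (T \<inter> U)" using T(1) \<open>open U\<close> by (rule open_Int)
    ultimately show "\<exists>V. open V \<and> p \<in> V \<and> V \<subseteq> U \<and> front_on V x ?n"
      using frontal_on_subset[OF assms(2), of "T \<inter> U"] \<open>p \<in> U\<close>
      by (intro exI[of _ "T \<inter> U"]) (auto simp: front_on_def)
  qed (auto simp: front_on_def)
  also have "\<dots> \<longleftrightarrow> (\<forall>v. Jac x p *v v = 0 \<and> Jac ?n p *v v = 0 \<longrightarrow> v = 0)"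
    using immersive_at_iff_kernel[OF pair[OF \<open>p \<in> U\<close>]] Jx[OF \<open>p \<in> U\<close>] Jn[OF \<open>p \<in> U\<close>]
    by (simp add: zero_prod_def)
  \<comment> \<open>The factor \<open>- (1 / 2)\<close> in the mean curvature does not affect its
    vanishing.\<close>
  finally show ?thesis
    using relative_curvature_criterion[OF \<open>inj ((*v) (\<Omega> p))\<close> X N sym u]
    by (simp add: rel_mean_curvature_def rel_curvature_def)
qed

end
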